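(* Let $W_{\mathcal{G}}$ and $W_{\mathcal{H}}$ be the graphons of two sets of graphs $\mathcal{G}$ and $\mathcal{H}$, let $\lambda\in[0,1]$, and let $W_{\mathcal{I}}=\lambda W_{\mathcal{G}}+(1-\lambda)W_{\mathcal{H}}$ be the mixed graphon. Let $n\ge 1$ be an integer, let $0<\varepsilon<1$, and let $F_{\mathcal{I}}$ be the mixed discriminative motif (a finite simple graph). Then the $W_{\mathcal{I}}$-random graph $\mathbb{G}=\mathbb{G}(n,W_{\mathcal{I}})$ satisfies $$\mathrm{P}\left(\left|t(F_{\mathcal{I}},\mathbb{G})-t(F_{\mathcal{I}},W_{\mathcal{I}})\right|>\varepsilon\right)\le 2\exp\left(-\frac{\varepsilon^2 n}{8\,\mathrm{v}(F_{\mathcal{I}})^2}\right).$$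
   Context: Graphs are finite, simple and undirected; $V(F)$ and $E(F)$ are the node set and edge set of a graph $F$, and $\mathrm{v}(F)=|V(F)|$ is its number of nodes. A graphon is a continuous, bounded, symmetric function $W:[0,1]^2\to[0,1]$. Each set of graphs $\mathcal{G}$ (the graphs of one class) has an associated graphon $W_{\mathcal{G}}$, regarded as the generator of the graphs in that set. A discriminative motif of a graph $G$ is the subgraph of $G$, with the minimal number of nodes and edges, that can decide the class of $G$. The mixed discriminative motif $F_{\mathcal{I}}$ is the discriminative motif associated with the mixed graphon $W_{\mathcal{I}}$; it is a finite simple graph. A graph homomorphism $F\to G$ is a map $\phi:V(F)\to V(G)$ such that $\{u,v\}\in E(F)$ implies $\{\phi(u),\phi(v)\}\in E(G)$; $\hom(F,G)$ is the number of such maps. The homomorphism density of $F$ in a graph $G$ is $$t(F,G)=\frac{\hom(F,G)}{|V(G)|^{|V(F)|}},$$ and the homomorphism density of $F$ in a graphon $W$ is $$t(F,W)=\int_{[0,1]^{V(F)}}\prod_{\{i,j\}\in E(F)}W(x_i,x_j)\prod_{i\in V(F)}dx_i .$$ The $W$-random graph $\mathbb{G}(n,W)$ is the random simple undirected graph on node set $\{1,\dots,n\}$ obtained as follows: sample $u_1,\dots,u_n$ independently and uniformly from $[0,1]$; then, conditionally on these, for each pair $i<j$ independently, include the edge $\{i,j\}$ with probability $W(u_i,u_j)$. *)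

theory Defs
  imports "HOL-Probability.Probability"
begin

record 'a ugraph =
  verts :: "'a set"
  edges :: "'a set set"

definition finite_simple_graph :: "'a ugraph \<Rightarrow> bool" where
  "finite_simple_graph G \<longleftrightarrow>
     finite (verts G) \<and> (\<forall>e\<in>edges G. e \<subseteq> verts G \<and> card e = 2)"

abbreviation num_verts :: "'a ugraph \<Rightarrow> nat" where
  "num_verts G \<equiv> card (verts G)"

text \<open>Homomorphisms are extensional functions, so that each map on the nodes of
  \<open>F\<close> is counted once.\<close>

definition homs :: "'a ugraph \<Rightarrow> 'b ugraph \<Rightarrow> ('a \<Rightarrow> 'b) set" where
  "homs F G = {\<phi> \<in> verts F \<rightarrow>\<^sub>E verts G. \<forall>u v. {u, v} \<in> edges F \<longrightarrow> {\<phi> u, \<phi> v} \<in> edges G}"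

definition hom_density :: "'a ugraph \<Rightarrow> 'b ugraph \<Rightarrow> real" where
  "hom_density F G = real (card (homs F G)) / real (num_verts G) ^ num_verts F"

text \<open>A graphon is represented by a function on the plane of which only the values on the
  unit square matter; boundedness is part of the range condition.\<close>

definition graphon :: "(real \<Rightarrow> real \<Rightarrow> real) \<Rightarrow> bool" where
  "graphon W \<longleftrightarrow>
     continuous_on ({0..1} \<times> {0..1}) (\<lambda>(x, y). W x y) \<and>
     (\<forall>x\<in>{0..1}. \<forall>y\<in>{0..1}. W x y \<in> {0..1}) \<and>
     (\<forall>x\<in>{0..1}. \<forall>y\<in>{0..1}. W x y = W y x)"

definition mixed_graphon ::
    "real \<Rightarrow> (real \<Rightarrow> real \<Rightarrow> real) \<Rightarrow> (real \<Rightarrow> real \<Rightarrow> real) \<Rightarrow> real \<Rightarrow> real \<Rightarrow> real" where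
  "mixed_graphon l W W' = (\<lambda>x y. l * W x y + (1 - l) * W' x y)"

text \<open>The uniform distribution on the unit interval. Its underlying space is the interval
  itself, so the values of a graphon outside the unit square play no role below.\<close>

definition unit_lborel :: "real measure" where
  "unit_lborel = restrict_space lborel {0..1}"

text \<open>The value \<open>W (x i) (x j)\<close> at the unordered pair \<open>e = {i, j}\<close>, which is unique by the
  symmetry of \<open>W\<close> (see \<open>edge_weight_doubleton\<close>).\<close>

definition edge_weight :: "(real \<Rightarrow> real \<Rightarrow> real) \<Rightarrow> ('a \<Rightarrow> real) \<Rightarrow> 'a set \<Rightarrow> real" where
  "edge_weight W x e = (THE w. \<exists>i j. e = {i, j} \<and> w = W (x i) (x j))"

definition graphon_density :: "'a ugraph \<Rightarrow> (real \<Rightarrow> real \<Rightarrow> real) \<Rightarrow> real" where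
  "graphon_density F W =
     (\<integral>x. (\<Prod>e\<in>edges F. edge_weight W x e) \<partial>(\<Pi>\<^sub>M i\<in>verts F. unit_lborel))"

definition node_pairs :: "nat \<Rightarrow> (nat \<times> nat) set" where
  "node_pairs n = {(i, j). 1 \<le> i \<and> i < j \<and> j \<le> n}"

definition graph_of_choice :: "nat \<Rightarrow> (nat \<times> nat \<Rightarrow> bool) \<Rightarrow> nat ugraph" where
  "graph_of_choice n c =
     \<lparr>verts = {1..n}, edges = {{i, j} | i j. (i, j) \<in> node_pairs n \<and> c (i, j)}\<rparr>"

text \<open>The conditional distribution of the \<open>W\<close>-random graph, given the sampled points \<open>u\<close>.\<close>

definition cond_W_random_graph ::
    "nat \<Rightarrow> (real \<Rightarrow> real \<Rightarrow> real) \<Rightarrow> (nat \<Rightarrow> real) \<Rightarrow> nat ugraph pmf" where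
  "cond_W_random_graph n W u =
     map_pmf (graph_of_choice n)
       (Pi_pmf (node_pairs n) False (\<lambda>(i, j). bernoulli_pmf (W (u i) (u j))))"

text \<open>The distribution of the \<open>W\<close>-random graph, in which every set of graphs is an event
  (see \<open>space_W_random_graph\<close>, \<open>sets_W_random_graph\<close> and \<open>prob_space_W_random_graph\<close>).\<close>

definition W_random_graph :: "nat \<Rightarrow> (real \<Rightarrow> real \<Rightarrow> real) \<Rightarrow> nat ugraph measure" where
  "W_random_graph n W =
     (\<Pi>\<^sub>M i\<in>{1..n}. unit_lborel) \<bind> (\<lambda>u. measure_pmf (cond_W_random_graph n W u))"

lemma graphon_mixed_graphon:
  assumes "graphon W" "graphon W'" "0 \<le> l" "l \<le> 1"
  shows "graphon (mixed_graphon l W W')"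
proof -
  have 1: "l * a + (1 - l) * b \<le> 1" if "a \<le> 1" "b \<le> 1" for a b :: real
    using convex_bound_le[OF that, of l "1 - l"] assms(3,4) by simp
  have "continuous_on ({0..1} \<times> {0..1}) (\<lambda>p. l * (\<lambda>(x, y). W x y) p + (1 - l) * (\<lambda>(x, y). W' x y) p)"
    using assms(1,2) unfolding graphon_def by (intro continuous_intros) auto
  then show ?thesis
    using assms 1 unfolding graphon_def mixed_graphon_def
    by (auto simp: case_prod_unfold)
qed

lemma edge_weight_doubleton:
  assumes "W (x i) (x j) = W (x j) (x i)"
  shows "edge_weight W x {i, j} = W (x i) (x j)"
  unfolding edge_weight_def using assms
  by (intro the_equality) (auto simp: doubleton_eq_iff)

lemma space_unit_lborel [simp]: "space unit_lborel = {0..1}"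
  by (simp add: unit_lborel_def space_restrict_space)

lemma sets_unit_lborel: "sets unit_lborel = sets (restrict_space borel {0..1})"
  unfolding unit_lborel_def by (intro sets_restrict_space_cong) simp

lemma prob_space_unit_lborel: "prob_space unit_lborel"
  by (rule prob_spaceI) (simp add: unit_lborel_def space_restrict_space emeasure_restrict_space)

lemma finite_node_pairs: "finite (node_pairs n)"
  by (rule finite_subset[of _ "{..n} \<times> {..n}"]) (auto simp: node_pairs_def)

lemma graphon_measurable:
  assumes "graphon W" and i: "i \<in> I" and j: "j \<in> I"
  shows "(\<lambda>u. W (u i) (u j)) \<in> borel_measurable (\<Pi>\<^sub>M i\<in>I. unit_lborel)"
proof -
  have "(\<lambda>p. (\<lambda>(x, y). W x y) p) \<in> borel_measurable (restrict_space borel ({0..1} \<times> {0..1}))"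
    (is "?W \<in> _")
    using assms(1) unfolding graphon_def by (intro borel_measurable_continuous_on_restrict) auto
  moreover have "(\<lambda>u. (u i, u j)) \<in> (\<Pi>\<^sub>M i\<in>I. unit_lborel) \<rightarrow>\<^sub>M restrict_space borel ({0..1} \<times> {0..1})"
  proof (rule measurable_restrict_space2)
    have inc: "(\<lambda>x. x) \<in> unit_lborel \<rightarrow>\<^sub>M borel"
      unfolding unit_lborel_def by (intro measurable_restrict_space1) simp
    have c: "(\<lambda>u. u k) \<in> (\<Pi>\<^sub>M i\<in>I. unit_lborel) \<rightarrow>\<^sub>M borel" if "k \<in> I" for k
      using measurable_compose[OF measurable_component_singleton[OF that] inc] .
    show "(\<lambda>u. (u i, u j)) \<in> borel_measurable (\<Pi>\<^sub>M i\<in>I. unit_lborel)"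
      using c[OF i] c[OF j] by (rule borel_measurable_Pair)
  qed (use i j in \<open>auto simp: space_PiM PiE_iff\<close>)
  ultimately show ?thesis
    using measurable_compose[of "\<lambda>u. (u i, u j)" _ _ ?W borel] by (simp only: prod.case)
qed

lemma cond_W_random_graph_measurable:
  assumes W: "graphon W"
  shows "(\<lambda>u. measure_pmf (cond_W_random_graph n W u))
           \<in> (\<Pi>\<^sub>M i\<in>{1..n}. unit_lborel) \<rightarrow>\<^sub>M subprob_algebra (count_space UNIV)"
proof (rule measurable_subprob_algebra)
  fix A :: "nat ugraph set"
  let ?M = "\<Pi>\<^sub>M i\<in>{1..n}. unit_lborel"
  let ?P = "node_pairs n"
  let ?S = "{c \<in> PiE_dflt ?P False (\<lambda>_. UNIV). graph_of_choice n c \<in> A}"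
  let ?w = "\<lambda>u (p :: nat \<times> nat) b. if b then W (u (fst p)) (u (snd p)) else 1 - W (u (fst p)) (u (snd p))"
  have fin: "finite ?S"
    using finite_PiE_dflt[OF finite_node_pairs, of n "\<lambda>_. UNIV :: bool set" False] by auto
  have eq: "emeasure (measure_pmf (cond_W_random_graph n W u)) A
      = ennreal (\<Sum>c\<in>?S. \<Prod>p\<in>?P. ?w u p (c p))" if u: "u \<in> space ?M" for u
  proof -
    let ?Q = "Pi_pmf ?P False (\<lambda>(i, j). bernoulli_pmf (W (u i) (u j)))"
    have b: "pmf (bernoulli_pmf (W (u i) (u j))) b = ?w u (i, j) b" if "(i, j) \<in> ?P" for i j b
    proof -
      have "u i \<in> {0..1}" "u j \<in> {0..1}"
        using u that by (auto simp: space_PiM node_pairs_def PiE_iff)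
      then have "W (u i) (u j) \<in> {0..1}"
        using W unfolding graphon_def by blast
      then show ?thesis by (cases b) auto
    qed
    have "measure ?Q (graph_of_choice n -` A) = measure ?Q ?S"
    proof (rule measure_eq_AE)
      have "c \<in> graph_of_choice n -` A \<longleftrightarrow> c \<in> ?S" if "c \<in> set_pmf ?Q" for c
      proof -
        have "\<forall>p. p \<notin> ?P \<longrightarrow> c p = False"
          using set_Pi_pmf_subset[OF finite_node_pairs, of n False] that by blast
        then show ?thesis by (simp add: PiE_dflt_def)
      qed
      then show "AE c in measure_pmf ?Q. c \<in> graph_of_choice n -` A \<longleftrightarrow> c \<in> ?S"
        unfolding AE_measure_pmf_iff by blast
    qed simp_all
    also have "\<dots> = (\<Sum>c\<in>?S. pmf ?Q c)"
      using fin by (rule measure_measure_pmf_finite)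
    also have "\<dots> = (\<Sum>c\<in>?S. \<Prod>p\<in>?P. ?w u p (c p))"
    proof (rule sum.cong[OF refl])
      fix c assume "c \<in> ?S"
      then have "pmf ?Q c = (\<Prod>p\<in>?P. pmf ((\<lambda>(i, j). bernoulli_pmf (W (u i) (u j))) p) (c p))"
        by (intro pmf_Pi' finite_node_pairs) (auto simp: PiE_dflt_def)
      also have "\<dots> = (\<Prod>p\<in>?P. ?w u p (c p))"
        by (rule prod.cong) (use b in auto)
      finally show "pmf ?Q c = (\<Prod>p\<in>?P. ?w u p (c p))" .
    qed
    finally show ?thesis
      by (simp add: cond_W_random_graph_def measure_pmf.emeasure_eq_measure)
  qed
  have m: "(\<lambda>u. W (u (fst p)) (u (snd p))) \<in> borel_measurable ?M" if "p \<in> ?P" for p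
    using that by (intro graphon_measurable[OF W]) (auto simp: node_pairs_def)
  have "(\<lambda>u. \<Sum>c\<in>?S. \<Prod>p\<in>?P. ?w u p (c p)) \<in> borel_measurable ?M"
  proof (intro borel_measurable_sum borel_measurable_prod)
    fix c p assume "p \<in> ?P"
    then show "(\<lambda>u. ?w u p (c p)) \<in> borel_measurable ?M"
      using m by (cases "c p") auto
  qed
  then have "(\<lambda>u. ennreal (\<Sum>c\<in>?S. \<Prod>p\<in>?P. ?w u p (c p))) \<in> borel_measurable ?M"
    by simp
  then show "(\<lambda>u. emeasure (measure_pmf (cond_W_random_graph n W u)) A) \<in> borel_measurable ?M"
    by (subst measurable_cong[OF eq])
qed (auto intro: prob_space_imp_subprob_space measure_pmf.prob_space_axioms)

lemma prob_space_sample_points: "prob_space (\<Pi>\<^sub>M i\<in>I. unit_lborel)"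
  by (intro prob_space_PiM prob_space_unit_lborel)

lemma sets_W_random_graph [simp]: "sets (W_random_graph n W) = UNIV"
  unfolding W_random_graph_def
  by (subst sets_bind[where N = "count_space UNIV"])
     (simp_all add: prob_space.not_empty[OF prob_space_sample_points])

lemma space_W_random_graph [simp]: "space (W_random_graph n W) = UNIV"
  using sets_eq_imp_space_eq[of "W_random_graph n W" "count_space UNIV"] by simp

lemma prob_space_W_random_graph:
  assumes "graphon W"
  shows "prob_space (W_random_graph n W)"
  unfolding W_random_graph_def
  by (rule prob_space.prob_space_bind[OF prob_space_sample_points _
        cond_W_random_graph_measurable[OF assms]])
     (simp add: measure_pmf.prob_space_axioms)

end

theory Submission
  imports Defs
begin

text \<open>
  The density \<open>t(F, G)\<close> of the random graph fluctuates in two independent stages. Given the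
  sampled points, it is a function of independent edge indicators, each of which changes it by at
  most \<open>k\<^sup>2 / n\<^sup>2\<close> where \<open>k = v(F)\<close>; its conditional mean is a function of the independent
  points, each of which changes it by at most \<open>k / n\<close>. The exponential moment form of McDiarmid's
  inequality, applied in both stages, gives concentration around the mean with variance proxy
  \<open>k\<^sup>4 / n\<^sup>2 + k\<^sup>2 / n\<close>. Injective maps from the nodes of \<open>F\<close> are homomorphisms with probability
  exactly \<open>t(F, W)\<close>, and at most a fraction \<open>k\<^sup>2 / n\<close> of all maps is not injective, so the mean
  is within \<open>k\<^sup>2 / n\<close> of \<open>t(F, W)\<close>. If \<open>\<epsilon>\<^sup>2 n \<le> 4 k\<^sup>2\<close>, the claimed bound is at least 1; otherwise
  the bias is at most \<open>\<epsilon> / 4\<close> and the variance proxy at most \<open>5 k\<^sup>2 / (4 n)\<close>, which suffices.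
\<close>

subsection \<open>Bounded differences\<close>

text \<open>Bounded differences control \<open>f x - f y\<close> but name no interval. The infimum
  \<open>a\<close> of the values supplies one: all values lie between \<open>a\<close> and
  \<open>a + c\<close>, so the interval form of Hoeffding's lemma applies.\<close>

lemma (in prob_space) Hoeffdings_lemma_oscillation:
  fixes f :: "'a \<Rightarrow> real"
  assumes f: "f \<in> borel_measurable M"
    and osc: "\<And>x y. x \<in> space M \<Longrightarrow> y \<in> space M \<Longrightarrow> f x - f y \<le> c"
    and l: "0 < l"
  shows "expectation (\<lambda>x. exp (l * (f x - expectation f))) \<le> exp (l\<^sup>2 * c\<^sup>2 / 8)"
proof -
  obtain x0 where x0: "x0 \<in> space M"
    using not_empty by blast
  define a where "a = Inf (f ` space M)"
  have bdd: "bdd_below (f ` space M)"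
    using osc[OF x0] by (intro bdd_belowI[where m = "f x0 - c"]) (auto simp: algebra_simps)
  have lower: "a \<le> f x" if "x \<in> space M" for x
    unfolding a_def using bdd that by (intro cInf_lower) auto
  have upper: "f x \<le> a + c" if "x \<in> space M" for x
  proof -
    have "f x - c \<le> a"
      unfolding a_def using x0 osc[OF that]
      by (intro cInf_greatest) (auto simp: algebra_simps)
    then show ?thesis by simp
  qed
  interpret interval_bounded_random_variable M f a "a + c"
    using f lower upper by unfold_locales auto
  show ?thesis
    using Hoeffdings_lemma_nn_integral[OF l] by (intro integral_real_bounded) auto
qed

text \<open>Coordinates are integrated out one at a time. This keeps the remaining difference
  bounds, and Hoeffding's lemma in coordinate \<open>i\<close> costs a factor
  \<open>exp (l\<^sup>2 * (c i)\<^sup>2 / 8)\<close>. The bound \<open>B\<close> supplies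
  integrability.\<close>

lemma (in product_prob_space) bounded_differences_mgf:
  fixes f :: "('i \<Rightarrow> 'a) \<Rightarrow> real"
  assumes "finite J" and "f \<in> borel_measurable (Pi\<^sub>M J M)"
    and "\<And>x. x \<in> space (Pi\<^sub>M J M) \<Longrightarrow> \<bar>f x\<bar> \<le> B"
    and "\<And>i x y. i \<in> J \<Longrightarrow> x \<in> space (Pi\<^sub>M J M) \<Longrightarrow> y \<in> space (M i) \<Longrightarrow> \<bar>f x - f (x(i := y))\<bar> \<le> c i"
    and l: "0 < l"
  shows "(\<integral>x. exp (l * (f x - (\<integral>x. f x \<partial>Pi\<^sub>M J M))) \<partial>Pi\<^sub>M J M) \<le> exp (l\<^sup>2 * (\<Sum>i\<in>J. (c i)\<^sup>2) / 8)"
  using assms(1-4)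
proof (induction J arbitrary: f)
  case empty
  then show ?case
    by (simp add: PiM_empty lebesgue_integral_count_space_finite)
next
  case (insert i J f)
  note f[measurable] = insert.prems(1)
  note bound = insert.prems(2) and diff = insert.prems(3)
  let ?P = "Pi\<^sub>M J M" and ?Q = "Pi\<^sub>M (insert i J) M"
  interpret PJ: prob_space ?P by (intro prob_space_PiM prob_space)
  interpret QJ: prob_space ?Q by (intro prob_space_PiM prob_space)
  have fun_upd_in: "x(i := y) \<in> space ?Q" if "x \<in> space ?P" "y \<in> space (M i)" for x y
    using that by (auto simp: space_PiM PiE_iff extensional_def)
  \<comment> \<open>\<open>g\<close> is the conditional mean given the coordinates in
    \<open>J\<close>. It takes the place of \<open>f\<close> in the induction hypothesis, so it must
    inherit the bound \<open>B\<close> and the differences \<open>c j\<close>.\<close>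
  define g where "g x = (\<integral>y. f (x(i := y)) \<partial>M i)" for x
  define mu where "mu = (\<integral>x. f x \<partial>?Q)"
  have pair[measurable]: "(\<lambda>(x, y). f (x(i := y))) \<in> borel_measurable (?P \<Otimes>\<^sub>M M i)"
    using measurable_compose[OF measurable_add_dim f] by (simp add: case_prod_unfold)
  have f_upd[measurable]: "(\<lambda>y. f (x(i := y))) \<in> borel_measurable (M i)" if "x \<in> space ?P" for x
    using measurable_Pair2[OF pair that] by simp
  have g[measurable]: "g \<in> borel_measurable ?P"
    unfolding g_def by (rule M.borel_measurable_lebesgue_integral) (rule pair)
  have f_int: "integrable (M i) (\<lambda>y. f (x(i := y)))" if "x \<in> space ?P" for x
    using that bound fun_upd_in
    by (intro M.integrable_const_bound[where B = B] f_upd AE_I2) auto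
  have g_bound: "\<bar>g x\<bar> \<le> B" if x: "x \<in> space ?P" for x
  proof -
    have "\<bar>g x\<bar> \<le> (\<integral>y. \<bar>f (x(i := y))\<bar> \<partial>M i)"
      unfolding g_def by (rule integral_abs_bound)
    also have "\<dots> \<le> (\<integral>y. B \<partial>M i)"
      using f_int[OF x] bound fun_upd_in[OF x] by (intro integral_mono) auto
    finally show ?thesis by (simp add: M.prob_space)
  qed
  have g_diff: "\<bar>g x - g (x(j := y))\<bar> \<le> c j"
    if j: "j \<in> J" and x: "x \<in> space ?P" and y: "y \<in> space (M j)" for j x y
  proof -
    have x': "x(j := y) \<in> space ?P"
      using j x y by (auto simp: space_PiM PiE_iff extensional_def)
    have "\<bar>g x - g (x(j := y))\<bar> = \<bar>\<integral>z. f (x(i := z)) - f (x(j := y, i := z)) \<partial>M i\<bar>"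
      unfolding g_def using f_int[OF x] f_int[OF x'] by simp
    also have "\<dots> \<le> (\<integral>z. \<bar>f (x(i := z)) - f (x(j := y, i := z))\<bar> \<partial>M i)"
      by (rule integral_abs_bound)
    also have "\<dots> \<le> (\<integral>z. c j \<partial>M i)"
    proof (intro integral_mono)
      fix z assume "z \<in> space (M i)"
      \<comment> \<open>The difference bound for \<open>f\<close> is applied at the point already
        extended by \<open>z\<close>; as \<open>i\<close> and \<open>j\<close> are distinct, the two
        updates commute.\<close>
      then have "\<bar>f (x(i := z)) - f ((x(i := z))(j := y))\<bar> \<le> c j"
        using j y by (intro diff fun_upd_in[OF x]) auto
      moreover have "i \<noteq> j" using j insert.hyps by auto
      ultimately show "\<bar>f (x(i := z)) - f (x(j := y, i := z))\<bar> \<le> c j"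
        by (simp add: fun_upd_twist)
    qed (use f_int[OF x] f_int[OF x'] in auto)
    finally show ?thesis by (simp add: M.prob_space)
  qed
  have f_Q: "integrable ?Q f"
    using bound by (intro QJ.integrable_const_bound[where B = B] AE_I2) auto
  have mu: "mu = (\<integral>x. g x \<partial>?P)"
    unfolding mu_def g_def using insert.hyps f_Q by (rule product_integral_insert)
  have mu_bound: "\<bar>mu\<bar> \<le> B"
  proof -
    have "\<bar>mu\<bar> \<le> (\<integral>x. \<bar>f x\<bar> \<partial>?Q)"
      unfolding mu_def by (rule integral_abs_bound)
    also have "\<dots> \<le> (\<integral>x. B \<partial>?Q)"
      using f_Q bound by (intro integral_mono) auto
    finally show ?thesis by (simp add: QJ.prob_space)
  qed
  have exp_bound: "norm (exp (l * (r - mu))) \<le> exp (l * (B + B))" if "\<bar>r\<bar> \<le> B" for r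
    using that mu_bound l by (auto intro!: mult_left_mono)
  \<comment> \<open>The exponent is split at \<open>g x\<close>, the mean of \<open>f\<close> in
    coordinate \<open>i\<close>: the summand \<open>g x - mu\<close> is constant in
    \<open>y\<close>, and Hoeffding's lemma bounds the rest.\<close>
  have step: "(\<integral>y. exp (l * (f (x(i := y)) - mu)) \<partial>M i) \<le> exp (l\<^sup>2 * (c i)\<^sup>2 / 8) * exp (l * (g x - mu))"
    if x: "x \<in> space ?P" for x
  proof -
    have "(\<integral>y. exp (l * (f (x(i := y)) - mu)) \<partial>M i)
        = (\<integral>y. exp (l * (f (x(i := y)) - g x)) * exp (l * (g x - mu)) \<partial>M i)"
      by (simp add: exp_add[symmetric] algebra_simps)
    also have "\<dots> = (\<integral>y. exp (l * (f (x(i := y)) - g x)) \<partial>M i) * exp (l * (g x - mu))"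
      by simp
    also have "\<dots> \<le> exp (l\<^sup>2 * (c i)\<^sup>2 / 8) * exp (l * (g x - mu))"
    proof (rule mult_right_mono)
      show "(\<integral>y. exp (l * (f (x(i := y)) - g x)) \<partial>M i) \<le> exp (l\<^sup>2 * (c i)\<^sup>2 / 8)"
        unfolding g_def
      proof (rule M.Hoeffdings_lemma_oscillation[OF f_upd[OF x] _ l])
        fix y z assume yz: "y \<in> space (M i)" "z \<in> space (M i)"
        \<comment> \<open>The second update overwrites the first, so the hypothesis compares any two
          values of coordinate \<open>i\<close>.\<close>
        have "\<bar>f (x(i := y)) - f ((x(i := y))(i := z))\<bar> \<le> c i"
          using yz by (intro diff fun_upd_in[OF x]) auto
        then show "f (x(i := y)) - f (x(i := z)) \<le> c i" by simp
      qed
    qed simp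
    finally show ?thesis .
  qed
  have "(\<integral>x. exp (l * (f x - mu)) \<partial>?Q) = (\<integral>x. (\<integral>y. exp (l * (f (x(i := y)) - mu)) \<partial>M i) \<partial>?P)"
    using insert.hyps exp_bound bound
    by (intro product_integral_insert QJ.integrable_const_bound[where B = "exp (l * (B + B))"] AE_I2)
       auto
  also have "\<dots> \<le> (\<integral>x. exp (l\<^sup>2 * (c i)\<^sup>2 / 8) * exp (l * (g x - mu)) \<partial>?P)"
  proof (rule integral_mono')
    show "integrable ?P (\<lambda>x. exp (l\<^sup>2 * (c i)\<^sup>2 / 8) * exp (l * (g x - mu)))"
      using exp_bound g_bound
      by (intro integrable_mult_right PJ.integrable_const_bound[where B = "exp (l * (B + B))"] AE_I2) auto
  qed (use step in auto)
  also have "\<dots> = exp (l\<^sup>2 * (c i)\<^sup>2 / 8) * (\<integral>x. exp (l * (g x - mu)) \<partial>?P)"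
    by simp
  also have "\<dots> \<le> exp (l\<^sup>2 * (c i)\<^sup>2 / 8) * exp (l\<^sup>2 * (\<Sum>i\<in>J. (c i)\<^sup>2) / 8)"
    unfolding mu by (intro mult_left_mono insert.IH g g_bound g_diff) auto
  also have "\<dots> = exp (l\<^sup>2 * (\<Sum>i\<in>insert i J. (c i)\<^sup>2) / 8)"
    using insert.hyps by (simp add: exp_add[symmetric] algebra_simps add_divide_distrib)
  finally show ?case
    unfolding mu_def .
qed

text \<open>\<open>Pi_pmf\<close> lives on total functions with default \<open>d\<close> outside
  \<open>J\<close>, the product measure on functions that are \<open>undefined\<close> there.
  Restriction to \<open>J\<close> carries one law to the other, and by \<open>restr\<close> it does
  not change the values of \<open>f\<close>.\<close>

lemma Pi_pmf_bounded_differences_mgf: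
  fixes p :: "'i \<Rightarrow> 'b :: finite pmf" and d :: 'b and f :: "('i \<Rightarrow> 'b) \<Rightarrow> real"
  assumes J: "finite J"
    and restr: "\<And>x. f (restrict x J) = f x"
    and bound: "\<And>x. \<bar>f x\<bar> \<le> B"
    and diff: "\<And>i x y. i \<in> J \<Longrightarrow> \<bar>f x - f (x(i := y))\<bar> \<le> c i"
    and l: "0 < l"
  defines "Q \<equiv> measure_pmf (Pi_pmf J d p)"
  shows "(\<integral>x. exp (l * (f x - (\<integral>x. f x \<partial>Q))) \<partial>Q) \<le> exp (l\<^sup>2 * (\<Sum>i\<in>J. (c i)\<^sup>2) / 8)"
proof -
  let ?M = "\<lambda>i. measure_pmf (p i)"
  interpret product_prob_space ?M J
    by unfold_locales
  \<comment> \<open>The finite value type makes the product space finite, and each singleton is a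
    box; hence the product sigma-algebra is discrete and every real function is measurable.\<close>
  have sets: "A \<in> sets (Pi\<^sub>M J ?M)" if "A \<subseteq> space (Pi\<^sub>M J ?M)" for A
  proof -
    have "finite (space (Pi\<^sub>M J ?M))"
      using J by (auto simp: space_PiM intro: finite_PiE)
    then have fin: "finite A"
      using that finite_subset by blast
    have "{x} \<in> sets (Pi\<^sub>M J ?M)" if x: "x \<in> space (Pi\<^sub>M J ?M)" for x
    proof -
      have "{x} = (\<Pi>\<^sub>E i\<in>J. {x i})"
        using x by (auto simp: space_PiM PiE_iff extensional_def fun_eq_iff) metis
      then show ?thesis
        using J by (auto intro: sets_PiM_I_finite)
    qed
    then have "(\<Union>x\<in>A. {x}) \<in> sets (Pi\<^sub>M J ?M)"
      using fin that by (intro sets.finite_UN) auto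
    then show ?thesis by simp
  qed
  have meas: "h \<in> borel_measurable (Pi\<^sub>M J ?M)" for h :: "_ \<Rightarrow> real"
    by (rule measurableI) (auto intro: sets)
  have restr_meas: "(\<lambda>x. restrict x J) \<in> Q \<rightarrow>\<^sub>M Pi\<^sub>M J ?M"
    unfolding Q_def by (auto simp: space_PiM)
  \<comment> \<open>A product measure is determined by its values on boxes, and on a box the law of
    the restriction factorizes as well.\<close>
  have distr: "distr Q (Pi\<^sub>M J ?M) (\<lambda>x. restrict x J) = Pi\<^sub>M J ?M"
  proof (rule PiM_eqI)
    fix A assume A: "\<And>i. i \<in> J \<Longrightarrow> A i \<in> sets (?M i)"
    have "(\<lambda>x. restrict x J) -` Pi\<^sub>E J A \<inter> space Q = Pi J A"
      by (auto simp: Q_def)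
    then have "emeasure (distr Q (Pi\<^sub>M J ?M) (\<lambda>x. restrict x J)) (Pi\<^sub>E J A) = emeasure Q (Pi J A)"
      using J A by (subst emeasure_distr[OF restr_meas]) (auto intro: sets_PiM_I_finite)
    also have "\<dots> = (\<Prod>i\<in>J. emeasure (?M i) (A i))"
      using J by (simp add: Q_def measure_pmf.emeasure_eq_measure measure_Pi_pmf_Pi prod_ennreal)
    finally show "emeasure (distr Q (Pi\<^sub>M J ?M) (\<lambda>x. restrict x J)) (Pi\<^sub>E J A) = (\<Prod>i\<in>J. emeasure (?M i) (A i))" .
  qed (use J in auto)
  have int: "(\<integral>x. h x \<partial>Pi\<^sub>M J ?M) = (\<integral>x. h (restrict x J) \<partial>Q)" for h :: "_ \<Rightarrow> real"
    using integral_distr[OF restr_meas meas, of h] by (simp add: distr)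
  show ?thesis
    using bounded_differences_mgf[OF J meas[of f], of B c l] bound diff l
    unfolding int restr by blast
qed

section \<open>Exponential tail bounds\<close>

text \<open>Chernoff's argument: the indicator of the event is dominated by
  \<open>exp (l * (f x - s))\<close>.\<close>

lemma measure_le_exp_mgf:
  fixes f :: "'a \<Rightarrow> real"
  assumes f: "\<And>x. x \<in> set_pmf p \<Longrightarrow> \<bar>f x\<bar> \<le> B" and l: "0 < l"
  shows "measure_pmf.prob p {x. s \<le> f x} \<le> exp (- l * s) * measure_pmf.expectation p (\<lambda>x. exp (l * f x))"
proof -
  have int: "integrable (measure_pmf p) (\<lambda>x. exp (l * f x))"
    using f l by (intro measure_pmf.integrable_const_bound[where B = "exp (l * B)"])
      (auto simp: AE_measure_pmf_iff abs_le_iff)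
  have "measure_pmf.prob p {x. s \<le> f x} = measure_pmf.expectation p (indicator {x. s \<le> f x})"
    by simp
  also have "\<dots> \<le> measure_pmf.expectation p (\<lambda>x. exp (- l * s) * exp (l * f x))"
  proof (rule integral_mono)
    fix x
    show "indicator {x. s \<le> f x} x \<le> exp (- l * s) * exp (l * f x)"
      using l by (auto simp: indicator_def exp_add[symmetric])
  qed (use int in \<open>auto intro: measure_pmf.integrable_const_bound[where B = 1]\<close>)
  finally show ?thesis by simp
qed

text \<open>The deviation \<open>f G - \<mu>\<close> splits at the conditional mean
  \<open>g u\<close>. Both exponential moments are bounded at the same \<open>l\<close>, so the
  variance proxies of the two stages add.\<close>

lemma W_random_graph_tail:
  fixes f :: "nat ugraph \<Rightarrow> real"
  assumes W: "graphon W"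
    and bound: "\<And>G. \<bar>f G\<bar> \<le> B"
    and edge: "\<And>c p b. p \<in> node_pairs n \<Longrightarrow>
      \<bar>f (graph_of_choice n c) - f (graph_of_choice n (c(p := b)))\<bar> \<le> \<alpha>"
    and node: "\<And>u i y. i \<in> {1..n} \<Longrightarrow> u \<in> {1..n} \<rightarrow>\<^sub>E {0..1} \<Longrightarrow> y \<in> {0..1} \<Longrightarrow>
      \<bar>measure_pmf.expectation (cond_W_random_graph n W u) f
        - measure_pmf.expectation (cond_W_random_graph n W (u(i := y))) f\<bar> \<le> \<beta>"
    and l: "0 < l"
  defines "\<mu> \<equiv> \<integral>u. measure_pmf.expectation (cond_W_random_graph n W u) f \<partial>(\<Pi>\<^sub>M i\<in>{1..n}. unit_lborel)"
  shows "measure (W_random_graph n W) {G. s \<le> f G - \<mu>}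
    \<le> exp (l\<^sup>2 * (real (card (node_pairs n)) * \<alpha>\<^sup>2 + real n * \<beta>\<^sup>2) / 8 - l * s)"
proof -
  let ?M = "\<Pi>\<^sub>M i\<in>{1..n}. unit_lborel"
  let ?C = "\<lambda>u. cond_W_random_graph n W u"
  let ?N = "real (card (node_pairs n))"
  interpret product_prob_space "\<lambda>_. unit_lborel" "{1..n}"
    by (intro product_prob_spaceI prob_space_unit_lborel)
  have meas_C: "(\<lambda>u. measure_pmf (?C u)) \<in> ?M \<rightarrow>\<^sub>M subprob_algebra (count_space UNIV)"
    using W by (rule cond_W_random_graph_measurable)
  define g where "g u = measure_pmf.expectation (?C u) f" for u
  have g: "g \<in> borel_measurable ?M"
    unfolding g_def using bound
    by (intro measurable_compose[OF meas_C] integral_measurable_subprob_algebra) auto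
  have g_bound: "\<bar>g u\<bar> \<le> B" for u
  proof -
    have int: "integrable (measure_pmf (?C u)) f"
      using bound by (intro measure_pmf.integrable_const_bound[where B = B]) auto
    have "\<bar>g u\<bar> \<le> measure_pmf.expectation (?C u) (\<lambda>G. \<bar>f G\<bar>)"
      unfolding g_def by (rule integral_abs_bound)
    also have "\<dots> \<le> measure_pmf.expectation (?C u) (\<lambda>_. B)"
      using int bound by (intro integral_mono) auto
    finally show ?thesis by simp
  qed
  \<comment> \<open>The bound is uniform in \<open>u\<close>: flipping one choice changes
    \<open>f\<close> by at most \<open>\<alpha>\<close>, whatever the points are.\<close>
  have cond_mgf: "measure_pmf.expectation (?C u) (\<lambda>G. exp (l * (f G - g u))) \<le> exp (l\<^sup>2 * (?N * \<alpha>\<^sup>2) / 8)" for u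
  proof -
    let ?Q = "Pi_pmf (node_pairs n) False (\<lambda>(i, j). bernoulli_pmf (W (u i) (u j)))"
    have restr: "f (graph_of_choice n (restrict c (node_pairs n))) = f (graph_of_choice n c)" for c
      by (rule arg_cong[where f = f]) (auto simp: graph_of_choice_def)
    show ?thesis
      using Pi_pmf_bounded_differences_mgf[where f = "\<lambda>c. f (graph_of_choice n c)" and c = "\<lambda>_. \<alpha>",
          OF finite_node_pairs restr bound edge l]
      unfolding g_def cond_W_random_graph_def by simp
  qed
  have cond_tail: "measure_pmf.prob (?C u) {G. s \<le> f G - \<mu>}
      \<le> exp (l\<^sup>2 * (?N * \<alpha>\<^sup>2) / 8 - l * s) * exp (l * (g u - \<mu>))" for u
  proof -
    have "measure_pmf.prob (?C u) {G. s \<le> f G - \<mu>}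
        \<le> exp (- l * s) * measure_pmf.expectation (?C u) (\<lambda>G. exp (l * (f G - \<mu>)))"
    proof (rule measure_le_exp_mgf[OF _ l])
      show "\<bar>f G - \<mu>\<bar> \<le> B + \<bar>\<mu>\<bar>" for G
        using bound[of G] by linarith
    qed
    \<comment> \<open>Given \<open>u\<close>, the factor \<open>exp (l * (g u - \<mu>))\<close> is
      constant and leaves the expectation.\<close>
    also have "(\<lambda>G. exp (l * (f G - \<mu>))) = (\<lambda>G. exp (l * (f G - g u)) * exp (l * (g u - \<mu>)))"
      by (simp add: exp_add[symmetric] algebra_simps)
    also have "exp (- l * s) * measure_pmf.expectation (?C u) \<dots>
        = (exp (- l * s) * exp (l * (g u - \<mu>))) * measure_pmf.expectation (?C u) (\<lambda>G. exp (l * (f G - g u)))"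
      by simp
    also have "\<dots> \<le> (exp (- l * s) * exp (l * (g u - \<mu>))) * exp (l\<^sup>2 * (?N * \<alpha>\<^sup>2) / 8)"
      using cond_mgf by (intro mult_left_mono) auto
    also have "\<dots> = exp (l\<^sup>2 * (?N * \<alpha>\<^sup>2) / 8 - l * s) * exp (l * (g u - \<mu>))"
      by (simp add: exp_add[symmetric] algebra_simps)
    finally show ?thesis .
  qed
  have "measure (W_random_graph n W) {G. s \<le> f G - \<mu>}
      = (\<integral>u. measure_pmf.prob (?C u) {G. s \<le> f G - \<mu>} \<partial>?M)"
    unfolding W_random_graph_def by (rule P.measure_bind[OF meas_C]) simp
  also have "\<dots> \<le> (\<integral>u. exp (l\<^sup>2 * (?N * \<alpha>\<^sup>2) / 8 - l * s) * exp (l * (g u - \<mu>)) \<partial>?M)"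
  proof (rule integral_mono')
    have "norm (exp (l * (g u - \<mu>))) \<le> exp (l * (B + \<bar>\<mu>\<bar>))" for u
      using g_bound[of u] l by (auto intro!: mult_left_mono)
    then show "integrable ?M (\<lambda>u. exp (l\<^sup>2 * (?N * \<alpha>\<^sup>2) / 8 - l * s) * exp (l * (g u - \<mu>)))"
      using g by (intro integrable_mult_right P.integrable_const_bound[where B = "exp (l * (B + \<bar>\<mu>\<bar>))"]) auto
  qed (use cond_tail in auto)
  also have "\<dots> = exp (l\<^sup>2 * (?N * \<alpha>\<^sup>2) / 8 - l * s) * (\<integral>u. exp (l * (g u - \<mu>)) \<partial>?M)"
    by simp
  \<comment> \<open>Second stage: bounded differences for \<open>g\<close> as a function of the
    sampled points.\<close>
  also have "\<dots> \<le> exp (l\<^sup>2 * (?N * \<alpha>\<^sup>2) / 8 - l * s) * exp (l\<^sup>2 * (\<Sum>i\<in>{1..n}. \<beta>\<^sup>2) / 8)"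
    unfolding \<mu>_def g_def[symmetric]
    using g_bound node
    by (intro mult_left_mono bounded_differences_mgf g l) (auto simp: g_def space_PiM)
  also have "\<dots> = exp (l\<^sup>2 * (?N * \<alpha>\<^sup>2 + real n * \<beta>\<^sup>2) / 8 - l * s)"
    by (simp add: exp_add[symmetric] algebra_simps add_divide_distrib)
  finally show ?thesis .
qed

subsection \<open>Counting maps and homomorphisms\<close>

lemma real_card_UN_le: "finite I \<Longrightarrow> real (card (\<Union>i\<in>I. A i)) \<le> (\<Sum>i\<in>I. real (card (A i)))"
  using card_UN_le[of I A] by (simp flip: of_nat_sum)

text \<open>The nodes outside \<open>S\<close> remain free. The quotient form exhibits the fraction
  \<open>1 / real (card N) ^ card S\<close> of all maps.\<close>

lemma card_PiE_fixed:
  assumes V: "finite V" and S: "S \<subseteq> V" and x: "x \<in> S \<rightarrow> N" and N: "finite N" "N \<noteq> {}"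
  shows "real (card {\<phi> \<in> V \<rightarrow>\<^sub>E N. \<forall>v\<in>S. \<phi> v = x v}) = real (card N) ^ card V / real (card N) ^ card S"
proof -
  have "{\<phi> \<in> V \<rightarrow>\<^sub>E N. \<forall>v\<in>S. \<phi> v = x v} = (\<Pi>\<^sub>E v\<in>V. if v \<in> S then {x v} else N)"
  proof (intro set_eqI iffI)
    fix \<phi> assume "\<phi> \<in> (\<Pi>\<^sub>E v\<in>V. if v \<in> S then {x v} else N)"
    then have *: "\<phi> v \<in> (if v \<in> S then {x v} else N)" "\<phi> \<in> extensional V" if "v \<in> V" for v
      using that by (auto simp: PiE_iff)
    have "\<phi> \<in> V \<rightarrow>\<^sub>E N"
    proof (rule PiE_I)
      fix v assume "v \<in> V"
      then show "\<phi> v \<in> N" using *(1)[of v] x by (cases "v \<in> S") auto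
    qed (use \<open>\<phi> \<in> PiE _ _\<close> in \<open>auto dest: PiE_arb\<close>)
    then show "\<phi> \<in> {\<phi> \<in> V \<rightarrow>\<^sub>E N. \<forall>v\<in>S. \<phi> v = x v}"
      using *(1) S by (force split: if_splits)
  qed (use S in \<open>auto simp: PiE_iff\<close>)
  then have "card {\<phi> \<in> V \<rightarrow>\<^sub>E N. \<forall>v\<in>S. \<phi> v = x v} = (\<Prod>v\<in>V. card (if v \<in> S then {x v} else N))"
    using V by (simp add: card_PiE)
  also have "\<dots> = (\<Prod>v\<in>V. if v \<in> S then 1 else card N)"
    by (rule prod.cong) auto
  also have "\<dots> = card N ^ card (V - S)"
    using V S by (simp add: prod.If_cases Diff_eq)
  also have "card (V - S) = card V - card S"
    using V S by (simp add: card_Diff_subset finite_subset)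
  finally have "real (card {\<phi> \<in> V \<rightarrow>\<^sub>E N. \<forall>v\<in>S. \<phi> v = x v}) = real (card N) ^ (card V - card S)"
    by (simp only: of_nat_power)
  then show ?thesis
    using N power_diff[of "real (card N)", OF _ card_mono[OF V S]] by simp
qed

text \<open>Union bound over the node sent to \<open>i\<close>, each contributing the fraction
  \<open>1 / real (card N)\<close>.\<close>

lemma card_PiE_hits_le:
  assumes V: "finite V" and N: "finite N" "i \<in> N"
  shows "real (card {\<phi> \<in> V \<rightarrow>\<^sub>E N. i \<in> \<phi> ` V}) / real (card N) ^ card V \<le> real (card V) / real (card N)"
proof -
  have pos: "real (card N) > 0"
    using N by (auto simp: card_gt_0_iff)
  have "{\<phi> \<in> V \<rightarrow>\<^sub>E N. i \<in> \<phi> ` V} = (\<Union>a\<in>V. {\<phi> \<in> V \<rightarrow>\<^sub>E N. \<forall>v\<in>{a}. \<phi> v = i})"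
    by auto
  then have "real (card {\<phi> \<in> V \<rightarrow>\<^sub>E N. i \<in> \<phi> ` V})
      \<le> (\<Sum>a\<in>V. real (card {\<phi> \<in> V \<rightarrow>\<^sub>E N. \<forall>v\<in>{a}. \<phi> v = i}))"
    by (simp only: real_card_UN_le[OF V])
  also have "\<dots> = (\<Sum>a\<in>V. real (card N) ^ card V / real (card N))"
    using V N by (intro sum.cong refl, subst card_PiE_fixed) auto
  finally show ?thesis
    using pos by (simp add: field_simps)
qed

lemma card_PiE_fixed_pair:
  assumes V: "finite V" and N: "finite N" "i \<in> N" "j \<in> N" and ab: "a \<in> V" "b \<in> V" "a \<noteq> b"
  shows "real (card {\<phi> \<in> V \<rightarrow>\<^sub>E N. \<phi> a = i \<and> \<phi> b = j}) = real (card N) ^ card V / (real (card N))\<^sup>2"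
proof -
  have "{\<phi> \<in> V \<rightarrow>\<^sub>E N. \<phi> a = i \<and> \<phi> b = j} = {\<phi> \<in> V \<rightarrow>\<^sub>E N. \<forall>v\<in>{a, b}. \<phi> v = (if v = a then i else j)}"
    using ab by auto
  also have "real (card \<dots>) = real (card N) ^ card V / real (card N) ^ card {a, b}"
    using V N ab by (intro card_PiE_fixed) auto
  finally show ?thesis
    using ab by (simp add: power2_eq_square)
qed

text \<open>Union bound over the ordered pairs of distinct nodes. The case \<open>i = j\<close> is
  included; it counts collisions.\<close>

lemma card_PiE_hits_pair_le:
  assumes V: "finite V" and N: "finite N" "i \<in> N" "j \<in> N"
  shows "real (card {\<phi> \<in> V \<rightarrow>\<^sub>E N. \<exists>a\<in>V. \<exists>b\<in>V. a \<noteq> b \<and> \<phi> a = i \<and> \<phi> b = j}) / real (card N) ^ card V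
    \<le> (real (card V))\<^sup>2 / (real (card N))\<^sup>2"
proof -
  have pos: "real (card N) > 0"
    using N by (auto simp: card_gt_0_iff)
  let ?D = "{(a, b) \<in> V \<times> V. a \<noteq> b}"
  let ?A = "\<lambda>(a, b). {\<phi> \<in> V \<rightarrow>\<^sub>E N. \<phi> a = i \<and> \<phi> b = j}"
  have D: "finite ?D" "card ?D \<le> card V * card V"
    using V card_mono[of "V \<times> V" ?D] by (auto simp: card_cartesian_product intro: finite_subset[of _ "V \<times> V"])
  have "{\<phi> \<in> V \<rightarrow>\<^sub>E N. \<exists>a\<in>V. \<exists>b\<in>V. a \<noteq> b \<and> \<phi> a = i \<and> \<phi> b = j} = (\<Union>d\<in>?D. ?A d)"
    by auto
  then have "real (card {\<phi> \<in> V \<rightarrow>\<^sub>E N. \<exists>a\<in>V. \<exists>b\<in>V. a \<noteq> b \<and> \<phi> a = i \<and> \<phi> b = j}) \<le> (\<Sum>d\<in>?D. real (card (?A d)))"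
    by (simp only: real_card_UN_le[OF D(1)])
  also have "\<dots> = (\<Sum>d\<in>?D. real (card N) ^ card V / (real (card N))\<^sup>2)"
    using V N card_PiE_fixed_pair[of V N i j] by (intro sum.cong refl) auto
  also have "\<dots> \<le> (real (card V))\<^sup>2 * (real (card N) ^ card V / (real (card N))\<^sup>2)"
    using D(2) by (simp only: sum_constant)
      (intro mult_right_mono, simp_all add: power2_eq_square flip: of_nat_mult)
  finally show ?thesis
    using pos by (simp add: field_simps)
qed

text \<open>A non-injective map has two nodes with a common value \<open>i\<close>. The pair count
  with both targets equal to \<open>i\<close> bounds each value, and there are \<open>card N\<close>
  of them.\<close>

lemma card_PiE_not_inj_le:
  assumes V: "finite V" and N: "finite N" "N \<noteq> {}"
  shows "real (card {\<phi> \<in> V \<rightarrow>\<^sub>E N. \<not> inj_on \<phi> V}) / real (card N) ^ card V \<le> (real (card V))\<^sup>2 / real (card N)"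
proof -
  have pos: "real (card N) > 0"
    using N by (auto simp: card_gt_0_iff)
  let ?A = "\<lambda>i. {\<phi> \<in> V \<rightarrow>\<^sub>E N. \<exists>a\<in>V. \<exists>b\<in>V. a \<noteq> b \<and> \<phi> a = i \<and> \<phi> b = i}"
  have "{\<phi> \<in> V \<rightarrow>\<^sub>E N. \<not> inj_on \<phi> V} = (\<Union>i\<in>N. ?A i)"
    by (auto simp: inj_on_def)
  then have "real (card {\<phi> \<in> V \<rightarrow>\<^sub>E N. \<not> inj_on \<phi> V}) \<le> (\<Sum>i\<in>N. real (card (?A i)))"
    by (simp only: real_card_UN_le[OF N(1)])
  also have "\<dots> \<le> (\<Sum>i\<in>N. (real (card V))\<^sup>2 / (real (card N))\<^sup>2 * real (card N) ^ card V)"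
  proof (rule sum_mono)
    fix i assume i: "i \<in> N"
    show "real (card (?A i)) \<le> (real (card V))\<^sup>2 / (real (card N))\<^sup>2 * real (card N) ^ card V"
      using card_PiE_hits_pair_le[OF V N(1) i i] pos by (subst (asm) pos_divide_le_eq) auto
  qed
  finally show ?thesis
    using pos by (simp add: field_simps power2_eq_square)
qed

section \<open>Homomorphism densities of chosen graphs\<close>

lemma homs_subset: "homs F G \<subseteq> verts F \<rightarrow>\<^sub>E verts G"
  by (auto simp: homs_def)

lemma hom_density_bounds:
  fixes F :: "'a ugraph" and G :: "'b ugraph"
  assumes "finite_simple_graph F"
  shows "0 \<le> hom_density F G" "hom_density F G \<le> 1"
proof -
  have F: "finite (verts F)"
    using assms by (simp add: finite_simple_graph_def)
  show "0 \<le> hom_density F G"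
    by (simp add: hom_density_def)
  show "hom_density F G \<le> 1"
  proof (cases "finite (verts G) \<or> verts F = {}")
    case True
    then have "finite (verts F \<rightarrow>\<^sub>E verts G)"
      using F by (auto intro: finite_PiE)
    then have "card (homs F G) \<le> card (verts F \<rightarrow>\<^sub>E verts G)"
      using homs_subset by (rule card_mono)
    also have "\<dots> = num_verts G ^ num_verts F"
      using F by (rule card_funcsetE)
    finally show ?thesis
      by (simp add: hom_density_def divide_le_eq_1 flip: of_nat_power) auto
  next
    \<comment> \<open>An infinite node set has cardinality 0 and \<open>verts F\<close> is nonempty,
      so the density is a division by zero, hence 0. The tail bound asks for boundedness at every
      \<open>G\<close>, including these.\<close>
    case False
    then show ?thesis
      using F by (simp add: hom_density_def power_0_left card_eq_0_iff)
  qed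
qed

lemma verts_graph_of_choice [simp]: "verts (graph_of_choice n c) = {1..n}"
  by (simp add: graph_of_choice_def)

lemma edges_graph_of_choice: "edges (graph_of_choice n c) = (\<lambda>(i, j). {i, j}) ` {p \<in> node_pairs n. c p}"
  by (auto simp: graph_of_choice_def)

text \<open>The two graphs differ at most in one edge \<open>{i, j}\<close>, so a map can gain or
  lose the homomorphism property only if it sends two distinct nodes to \<open>i\<close> and
  \<open>j\<close>.\<close>

lemma hom_density_graph_of_choice_diff:
  fixes F :: "'a ugraph"
  assumes F: "finite_simple_graph F" and p: "p \<in> node_pairs n"
  shows "\<bar>hom_density F (graph_of_choice n c) - hom_density F (graph_of_choice n (c(p := b)))\<bar>
    \<le> (real (num_verts F))\<^sup>2 / (real n)\<^sup>2"
proof -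
  let ?G = "graph_of_choice n c" and ?G' = "graph_of_choice n (c(p := b))"
  let ?V = "verts F"
  obtain i j where ij: "p = (i, j)" "i \<in> {1..n}" "j \<in> {1..n}"
    using p by (cases p) (auto simp: node_pairs_def)
  let ?D = "{\<phi> \<in> ?V \<rightarrow>\<^sub>E {1..n}. \<exists>a\<in>?V. \<exists>b\<in>?V. a \<noteq> b \<and> \<phi> a = i \<and> \<phi> b = j}"
  have V: "finite ?V" using F by (simp add: finite_simple_graph_def)
  have fin: "finite (?V \<rightarrow>\<^sub>E {1..n})" using V by (auto intro: finite_PiE)
  have edges: "e \<in> edges ?G \<longleftrightarrow> e \<in> edges ?G'" if "e \<noteq> {i, j}" for e
    using that ij by (auto simp: edges_graph_of_choice image_iff split: prod.splits)
  have "(\<phi> \<in> homs F ?G \<longleftrightarrow> \<phi> \<in> homs F ?G')" if \<phi>: "\<phi> \<notin> ?D" for \<phi>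
  proof (cases "\<phi> \<in> ?V \<rightarrow>\<^sub>E {1..n}")
    case True
    \<comment> \<open>An edge of \<open>F\<close> has distinct ends; if it were mapped onto
      \<open>{i, j}\<close>, one end would go to \<open>i\<close> and the other to \<open>j\<close>,
      which puts \<open>\<phi>\<close> into \<open>?D\<close>.\<close>
    have "{\<phi> a, \<phi> b} \<noteq> {i, j}" if ab: "{a, b} \<in> edges F" for a b
    proof
      have "a \<in> ?V" "b \<in> ?V" "a \<noteq> b"
        using F ab by (auto simp: finite_simple_graph_def)
      moreover assume "{\<phi> a, \<phi> b} = {i, j}"
      ultimately show False
        using \<phi> True by (auto simp: doubleton_eq_iff)
    qed
    then show ?thesis
      using True edges by (auto simp: homs_def)
  qed (auto simp: homs_def)
  then have sub: "homs F ?G \<subseteq> homs F ?G' \<union> ?D" "homs F ?G' \<subseteq> homs F ?G \<union> ?D"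
    by blast+
  have fin': "finite (homs F ?G)" "finite (homs F ?G')" "finite ?D"
    using fin homs_subset[of F ?G] homs_subset[of F ?G'] finite_subset by fastforce+
  have "card (homs F ?G) \<le> card (homs F ?G') + card ?D" "card (homs F ?G') \<le> card (homs F ?G) + card ?D"
    using sub fin' by (meson card_Un_le card_mono finite_UnI le_trans)+
  then have "\<bar>real (card (homs F ?G)) - real (card (homs F ?G'))\<bar> \<le> real (card ?D)"
    by linarith
  then have "\<bar>hom_density F ?G - hom_density F ?G'\<bar> \<le> real (card ?D) / real (card {1..n}) ^ card ?V"
    by (simp add: hom_density_def divide_right_mono flip: diff_divide_distrib)
  also have "\<dots> \<le> (real (card ?V))\<^sup>2 / (real (card {1..n}))\<^sup>2"
    using V ij by (intro card_PiE_hits_pair_le) auto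
  finally show ?thesis by simp
qed

subsection \<open>Conditional probabilities of homomorphisms\<close>

text \<open>Weaker than injectivity, since nonadjacent nodes may share an image. Only a collapsed
  edge is fatal, because the random graph has no loops.\<close>

definition injective_on_edges :: "'a ugraph \<Rightarrow> ('a \<Rightarrow> 'b) \<Rightarrow> bool" where
  "injective_on_edges F \<phi> \<longleftrightarrow> (\<forall>e\<in>edges F. card (\<phi> ` e) = 2)"

text \<open>The indices of the choices that must succeed for \<open>\<phi>\<close> to be a
  homomorphism. As a set, it counts once an image edge shared by several edges of
  \<open>F\<close>.\<close>

definition image_pairs :: "'a ugraph \<Rightarrow> nat \<Rightarrow> ('a \<Rightarrow> nat) \<Rightarrow> (nat \<times> nat) set" where
  "image_pairs F n \<phi> = {p \<in> node_pairs n. {fst p, snd p} \<in> (`) \<phi> ` edges F}"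

lemma edge_doubletonE:
  assumes "finite_simple_graph F" "e \<in> edges F"
  obtains a b where "e = {a, b}" "a \<noteq> b" "a \<in> verts F" "b \<in> verts F"
  using assms by (fastforce simp: finite_simple_graph_def card_2_iff)

lemma node_pairsE:
  assumes "x \<in> {1..n}" "y \<in> {1..n}" "x \<noteq> y"
  obtains p where "p \<in> node_pairs n" "{fst p, snd p} = {x, y}"
proof (cases "x < y")
  case True
  then show ?thesis using assms that[of "(x, y)"] by (auto simp: node_pairs_def)
next
  case False
  then show ?thesis using assms that[of "(y, x)"] by (auto simp: node_pairs_def)
qed

lemma inj_on_node_pairs: "inj_on (\<lambda>p. {fst p, snd p}) (node_pairs n)"
  by (auto simp: inj_on_def node_pairs_def doubleton_eq_iff)

lemma mem_edges_graph_of_choice: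
  assumes "p \<in> node_pairs n"
  shows "{fst p, snd p} \<in> edges (graph_of_choice n c) \<longleftrightarrow> c p"
  using inj_on_image_mem_iff[OF inj_on_node_pairs assms, of "{p \<in> node_pairs n. c p}"] assms
  by (auto simp: edges_graph_of_choice case_prod_unfold)

text \<open>A loopless target excludes maps that collapse an edge. For the others the event is a
  cylinder set in the independent choices, whose probability factorizes.\<close>

lemma homs_graph_of_choice_iff:
  assumes F: "finite_simple_graph F" and \<phi>: "\<phi> \<in> verts F \<rightarrow>\<^sub>E {1..n}"
  shows "\<phi> \<in> homs F (graph_of_choice n c) \<longleftrightarrow> injective_on_edges F \<phi> \<and> (\<forall>p\<in>image_pairs F n \<phi>. c p)"
proof (intro iffI conjI)
  assume h: "\<phi> \<in> homs F (graph_of_choice n c)"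
  have img: "\<phi> ` e \<in> edges (graph_of_choice n c)" if e: "e \<in> edges F" for e
    using F e
  proof (rule edge_doubletonE)
    fix a b assume "e = {a, b}"
    then show ?thesis using h e by (simp add: homs_def)
  qed
  show "injective_on_edges F \<phi>"
    unfolding injective_on_edges_def
  proof
    fix e assume "e \<in> edges F"
    from img[OF this] show "card (\<phi> ` e) = 2"
      by (auto simp: edges_graph_of_choice node_pairs_def)
  qed
  show "\<forall>p\<in>image_pairs F n \<phi>. c p"
    using img mem_edges_graph_of_choice by (fastforce simp: image_pairs_def)
next
  assume h: "injective_on_edges F \<phi> \<and> (\<forall>p\<in>image_pairs F n \<phi>. c p)"
  have "{\<phi> a, \<phi> b} \<in> edges (graph_of_choice n c)" if e: "{a, b} \<in> edges F" for a b
  proof -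
    have "a \<in> verts F" "b \<in> verts F"
      using F e by (auto simp: finite_simple_graph_def)
    then have "\<phi> a \<in> {1..n}" "\<phi> b \<in> {1..n}"
      using \<phi> by auto
    moreover have "\<phi> a \<noteq> \<phi> b"
      using h e by (fastforce simp: injective_on_edges_def)
    ultimately obtain p where p: "p \<in> node_pairs n" "{fst p, snd p} = {\<phi> a, \<phi> b}"
      by (rule node_pairsE)
    then have "p \<in> image_pairs F n \<phi>"
      using e by (auto simp: image_pairs_def intro!: image_eqI[of _ _ "{a, b}"])
    then show ?thesis
      using h mem_edges_graph_of_choice[OF p(1)] p(2) by metis
  qed
  then show "\<phi> \<in> homs F (graph_of_choice n c)"
    using \<phi> by (simp add: homs_def)
qed

lemma graphon_bounds:
  assumes "graphon W" "x \<in> {0..1}" "y \<in> {0..1}"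
  shows "0 \<le> W x y" "W x y \<le> 1"
  using assms by (auto simp: graphon_def)

text \<open>Independence gives one factor for each distinct image pair, even where several edges of
  \<open>F\<close> share it.\<close>

lemma prob_hom_cond_W_random_graph:
  assumes F: "finite_simple_graph F" and \<phi>: "\<phi> \<in> verts F \<rightarrow>\<^sub>E {1..n}"
    and W: "graphon W" and u: "u \<in> {1..n} \<rightarrow>\<^sub>E {0..1}"
  shows "measure_pmf.prob (cond_W_random_graph n W u) {G. \<phi> \<in> homs F G}
    = (if injective_on_edges F \<phi> then \<Prod>p\<in>image_pairs F n \<phi>. W (u (fst p)) (u (snd p)) else 0)"
proof -
  let ?B = "\<lambda>(i, j). bernoulli_pmf (W (u i) (u j))"
  let ?Q = "Pi_pmf (node_pairs n) False ?B"
  \<comment> \<open>The sides of the cylinder set: an unconstrained pair gets the whole type and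
    contributes the factor 1.\<close>
  let ?T = "\<lambda>p. if {fst p, snd p} \<in> (`) \<phi> ` edges F then {True} else UNIV"
  have eq: "measure_pmf.prob (cond_W_random_graph n W u) {G. \<phi> \<in> homs F G}
      = measure_pmf.prob ?Q {c. injective_on_edges F \<phi> \<and> (\<forall>p\<in>image_pairs F n \<phi>. c p)}"
    unfolding cond_W_random_graph_def
    by (simp add: vimage_def homs_graph_of_choice_iff[OF F \<phi>])
  show ?thesis
  proof (cases "injective_on_edges F \<phi>")
    case True
    have "{c. \<forall>p\<in>image_pairs F n \<phi>. c p} = Pi (node_pairs n) ?T"
      by (simp add: set_eq_iff Pi_iff image_pairs_def Ball_def) blast
    then have "measure_pmf.prob (cond_W_random_graph n W u) {G. \<phi> \<in> homs F G}
        = (\<Prod>p\<in>node_pairs n. measure_pmf.prob (?B p) (?T p))"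
      using True eq measure_Pi_pmf_Pi[OF finite_node_pairs] by simp
    also have "\<dots> = (\<Prod>p\<in>node_pairs n.
        if {fst p, snd p} \<in> (`) \<phi> ` edges F then W (u (fst p)) (u (snd p)) else 1)"
    proof (rule prod.cong[OF refl])
      fix p assume "p \<in> node_pairs n"
      \<comment> \<open>\<open>bernoulli_pmf\<close> truncates its parameter to the unit interval,
        so the success probability is \<open>W\<close> itself only once its range is known.\<close>
      then have "u (fst p) \<in> {0..1}" "u (snd p) \<in> {0..1}"
        using u by (auto simp: node_pairs_def)
      then show "measure_pmf.prob (?B p) (?T p)
          = (if {fst p, snd p} \<in> (`) \<phi> ` edges F then W (u (fst p)) (u (snd p)) else 1)"
        using graphon_bounds[OF W] by (simp add: case_prod_unfold measure_pmf_single)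
    qed
    also have "\<dots> = (\<Prod>p\<in>image_pairs F n \<phi>. W (u (fst p)) (u (snd p)))"
      unfolding image_pairs_def using finite_node_pairs by (simp only: prod.inter_filter)
    finally show ?thesis using True by simp
  qed (simp add: eq)
qed

section \<open>The conditional mean density\<close>

text \<open>Linearity of expectation, with the number of homomorphisms written as a sum of
  indicators over all maps.\<close>

lemma expectation_hom_density_cond_W_random_graph:
  assumes F: "finite_simple_graph F"
  shows "measure_pmf.expectation (cond_W_random_graph n W u) (hom_density F)
    = (\<Sum>\<phi>\<in>verts F \<rightarrow>\<^sub>E {1..n}. measure_pmf.prob (cond_W_random_graph n W u) {G. \<phi> \<in> homs F G})
      / real n ^ num_verts F"
proof -
  let ?C = "cond_W_random_graph n W u" and ?X = "verts F \<rightarrow>\<^sub>E {1..n}"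
  have X: "finite ?X"
    using F by (auto simp: finite_simple_graph_def intro: finite_PiE)
  \<comment> \<open>On the support the node set is \<open>{1..n}\<close>, which fixes both the
    candidate maps and the denominator.\<close>
  have "hom_density F G = (\<Sum>\<phi>\<in>?X. indicator {G. \<phi> \<in> homs F G} G) / real n ^ num_verts F"
    if "G \<in> set_pmf ?C" for G
  proof -
    have "verts G = {1..n}"
      using that by (auto simp: cond_W_random_graph_def)
    then have "homs F G = {\<phi> \<in> ?X. \<phi> \<in> homs F G}"
      using homs_subset[of F G] by auto
    then have "real (card (homs F G)) = (\<Sum>\<phi>\<in>?X. indicator {G. \<phi> \<in> homs F G} G)"
      using X by (simp add: indicator_def sum.If_cases Int_def)
    then show ?thesis
      using \<open>verts G = {1..n}\<close> by (simp add: hom_density_def)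
  qed
  then have "measure_pmf.expectation ?C (hom_density F)
      = measure_pmf.expectation ?C (\<lambda>G. (\<Sum>\<phi>\<in>?X. indicator {G. \<phi> \<in> homs F G} G) / real n ^ num_verts F)"
    by (intro integral_cong_AE) (auto simp: AE_measure_pmf_iff)
  also have "\<dots> = (\<Sum>\<phi>\<in>?X. measure_pmf.expectation ?C (indicator {G. \<phi> \<in> homs F G})) / real n ^ num_verts F"
    by (subst Bochner_Integration.integral_divide_zero, subst Bochner_Integration.integral_sum)
      (auto intro: measure_pmf.integrable_const_bound[where B = 1])
  finally show ?thesis by simp
qed

text \<open>The probability that \<open>\<phi>\<close> is a homomorphism depends only on the points
  at its image nodes. Moving point \<open>i\<close> thus affects only the maps that hit
  \<open>i\<close>, each by at most 1.\<close>

lemma expectation_hom_density_node_diff: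
  assumes F: "finite_simple_graph F" and W: "graphon W"
    and i: "i \<in> {1..n}" and u: "u \<in> {1..n} \<rightarrow>\<^sub>E {0..1}" and y: "y \<in> {0..1}"
  shows "\<bar>measure_pmf.expectation (cond_W_random_graph n W u) (hom_density F)
      - measure_pmf.expectation (cond_W_random_graph n W (u(i := y))) (hom_density F)\<bar>
    \<le> real (num_verts F) / real n"
proof -
  let ?X = "verts F \<rightarrow>\<^sub>E {1..n}"
  let ?q = "\<lambda>u \<phi>. measure_pmf.prob (cond_W_random_graph n W u) {G. \<phi> \<in> homs F G}"
  have V: "finite (verts F)"
    using F by (simp add: finite_simple_graph_def)
  have X: "finite ?X"
    using V by (auto intro: finite_PiE)
  have u': "u(i := y) \<in> {1..n} \<rightarrow>\<^sub>E {0..1}"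
    using i u y by (auto simp: PiE_iff extensional_def)
  have diff: "\<bar>?q u \<phi> - ?q (u(i := y)) \<phi>\<bar> \<le> indicator {\<phi>. i \<in> \<phi> ` verts F} \<phi>" if \<phi>: "\<phi> \<in> ?X" for \<phi>
  proof (cases "i \<in> \<phi> ` verts F")
    case True
    have "0 \<le> ?q u \<phi>" "?q u \<phi> \<le> 1" "0 \<le> ?q (u(i := y)) \<phi>" "?q (u(i := y)) \<phi> \<le> 1"
      by simp_all
    then have "\<bar>?q u \<phi> - ?q (u(i := y)) \<phi>\<bar> \<le> 1"
      by linarith
    then show ?thesis using True by simp
  next
    case False
    have "fst p \<noteq> i \<and> snd p \<noteq> i" if p: "p \<in> image_pairs F n \<phi>" for p
    proof -
      obtain e where e: "e \<in> edges F" "{fst p, snd p} = \<phi> ` e"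
        using p by (auto simp: image_pairs_def)
      then have "e \<subseteq> verts F"
        using F by (auto simp: finite_simple_graph_def)
      then have "{fst p, snd p} \<subseteq> \<phi> ` verts F"
        unfolding e(2) by (rule image_mono)
      then show ?thesis using False by auto
    qed
    then have "?q u \<phi> = ?q (u(i := y)) \<phi>"
      unfolding prob_hom_cond_W_random_graph[OF F \<phi> W u] prob_hom_cond_W_random_graph[OF F \<phi> W u']
      by (auto intro!: prod.cong)
    then show ?thesis by simp
  qed
  have "\<bar>(\<Sum>\<phi>\<in>?X. ?q u \<phi>) - (\<Sum>\<phi>\<in>?X. ?q (u(i := y)) \<phi>)\<bar> \<le> (\<Sum>\<phi>\<in>?X. indicator {\<phi>. i \<in> \<phi> ` verts F} \<phi>)"
    unfolding sum_subtractf[symmetric] using diff by (intro order.trans[OF sum_abs] sum_mono)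
  also have "\<dots> = real (card {\<phi> \<in> ?X. i \<in> \<phi> ` verts F})"
    using X by (simp add: indicator_def sum.If_cases Int_def)
  finally have "\<bar>(\<Sum>\<phi>\<in>?X. ?q u \<phi>) / real n ^ num_verts F - (\<Sum>\<phi>\<in>?X. ?q (u(i := y)) \<phi>) / real n ^ num_verts F\<bar>
      \<le> real (card {\<phi> \<in> ?X. i \<in> \<phi> ` verts F}) / real (card {1..n}) ^ num_verts F"
    by (simp add: divide_right_mono flip: diff_divide_distrib)
  also have "\<dots> \<le> real (num_verts F) / real (card {1..n})"
    using V i by (intro card_PiE_hits_le) auto
  finally show ?thesis
    unfolding expectation_hom_density_cond_W_random_graph[OF F] by simp
qed

subsection \<open>The mean density and concentration\<close>

lemma edge_weight_graphon:
  assumes "graphon W" "x a \<in> {0..1}" "x b \<in> {0..1}"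
  shows "edge_weight W x {a, b} = W (x a) (x b)"
  using assms by (intro edge_weight_doubleton) (auto simp: graphon_def)

lemma edge_weight_bounds:
  assumes F: "finite_simple_graph F" and W: "graphon W"
    and x: "x \<in> verts F \<rightarrow>\<^sub>E {0..1}" and e: "e \<in> edges F"
  shows "0 \<le> edge_weight W x e" "edge_weight W x e \<le> 1"
proof -
  obtain a b where e: "e = {a, b}" "a \<in> verts F" "b \<in> verts F"
    using F e by (rule edge_doubletonE)
  have ab: "x a \<in> {0..1}" "x b \<in> {0..1}"
    using x e by auto
  show "0 \<le> edge_weight W x e" "edge_weight W x e \<le> 1"
    using graphon_bounds[OF W ab] by (simp_all only: e(1) edge_weight_graphon[where x = x, OF W ab])
qed

lemma measurable_prod_edge_weight:
  assumes F: "finite_simple_graph F" and W: "graphon W"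
  shows "(\<lambda>x. \<Prod>e\<in>edges F. edge_weight W x e) \<in> borel_measurable (\<Pi>\<^sub>M i\<in>verts F. unit_lborel)"
proof (rule borel_measurable_prod)
  fix e assume "e \<in> edges F"
  with F obtain a b where e: "e = {a, b}" "a \<in> verts F" "b \<in> verts F"
    by (rule edge_doubletonE)
  \<comment> \<open>\<open>edge_weight\<close> is a definite description, evaluated here by the
    symmetry of \<open>W\<close> on the unit square; measurability then transfers from
    \<open>W\<close> by agreement on the space.\<close>
  have "edge_weight W x e = W (x a) (x b)" if "x \<in> space (\<Pi>\<^sub>M i\<in>verts F. unit_lborel)" for x
  proof -
    have "x a \<in> {0..1}" "x b \<in> {0..1}"
      using that e by (auto simp: space_PiM)
    then show ?thesis
      unfolding e(1) by (rule edge_weight_graphon[OF W])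
  qed
  then show "(\<lambda>x. edge_weight W x e) \<in> borel_measurable (\<Pi>\<^sub>M i\<in>verts F. unit_lborel)"
    using graphon_measurable[OF W e(2,3)] by (subst measurable_cong) auto
qed

lemma graphon_density_bounds:
  assumes F: "finite_simple_graph F" and W: "graphon W"
  shows "0 \<le> graphon_density F W" "graphon_density F W \<le> 1"
proof -
  let ?M = "\<Pi>\<^sub>M i\<in>verts F. unit_lborel"
  interpret prob_space ?M by (rule prob_space_sample_points)
  have *: "0 \<le> (\<Prod>e\<in>edges F. edge_weight W x e)" "(\<Prod>e\<in>edges F. edge_weight W x e) \<le> 1"
    if "x \<in> space ?M" for x
    using that edge_weight_bounds[OF F W, of x] by (auto simp: space_PiM intro!: prod_nonneg prod_le_1)
  then show "0 \<le> graphon_density F W"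
    unfolding graphon_density_def by (intro Bochner_Integration.integral_nonneg) auto
  have "graphon_density F W \<le> (\<integral>x. 1 \<partial>?M)"
    unfolding graphon_density_def using * by (intro integral_mono') auto
  then show "graphon_density F W \<le> 1"
    by (simp add: prob_space)
qed

text \<open>Injectivity on nodes gives distinct edges distinct images, so no factors merge and the
  edges of \<open>F\<close> correspond to the image pairs.\<close>

lemma prod_edge_weight_compose:
  assumes F: "finite_simple_graph F" and W: "graphon W"
    and \<phi>: "\<phi> \<in> verts F \<rightarrow>\<^sub>E {1..n}" and inj: "inj_on \<phi> (verts F)"
    and u: "u \<in> {1..n} \<rightarrow>\<^sub>E {0..1}"
  shows "(\<Prod>e\<in>edges F. edge_weight W (\<lambda>v\<in>verts F. u (\<phi> v)) e)
    = (\<Prod>p\<in>image_pairs F n \<phi>. W (u (fst p)) (u (snd p)))"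
proof -
  have "edge_weight W (\<lambda>v\<in>verts F. u (\<phi> v)) e = edge_weight W u (\<phi> ` e)" if "e \<in> edges F" for e
  proof -
    obtain a b where ab: "e = {a, b}" "a \<in> verts F" "b \<in> verts F"
      using F \<open>e \<in> edges F\<close> by (rule edge_doubletonE)
    then have "\<phi> a \<in> {1..n}" "\<phi> b \<in> {1..n}"
      using \<phi> by auto
    then have "u (\<phi> a) \<in> {0..1}" "u (\<phi> b) \<in> {0..1}"
      using u by blast+
    then show ?thesis
      using ab by (simp add: edge_weight_graphon[OF W])
  qed
  then have "(\<Prod>e\<in>edges F. edge_weight W (\<lambda>v\<in>verts F. u (\<phi> v)) e) = (\<Prod>e\<in>edges F. edge_weight W u (\<phi> ` e))"
    by simp
  also have "\<dots> = (\<Prod>d\<in>(`) \<phi> ` edges F. edge_weight W u d)"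
  proof -
    have "inj_on ((`) \<phi>) (edges F)"
    proof (rule inj_on_subset)
      show "inj_on ((`) \<phi>) (Pow (verts F))" using inj by (rule inj_on_image_Pow)
      show "edges F \<subseteq> Pow (verts F)" using F by (auto simp: finite_simple_graph_def)
    qed
    then show ?thesis by (simp add: prod.reindex)
  qed
  \<comment> \<open>Each image edge has two distinct ends in \<open>{1..n}\<close>, so it is listed
    by an increasing pair.\<close>
  also have "(`) \<phi> ` edges F = (\<lambda>p. {fst p, snd p}) ` image_pairs F n \<phi>"
  proof (intro set_eqI iffI)
    fix d assume "d \<in> (`) \<phi> ` edges F"
    then obtain e where e: "e \<in> edges F" "d = \<phi> ` e" by auto
    with F obtain a b where ab: "e = {a, b}" "a \<noteq> b" "a \<in> verts F" "b \<in> verts F"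
      by (auto elim: edge_doubletonE)
    then have "\<phi> a \<in> {1..n}" "\<phi> b \<in> {1..n}" "\<phi> a \<noteq> \<phi> b"
      using \<phi> inj by (auto dest: inj_onD)
    then obtain p where p: "p \<in> node_pairs n" "{fst p, snd p} = {\<phi> a, \<phi> b}"
      by (rule node_pairsE)
    have d: "d = {fst p, snd p}"
      using e(2) ab(1) p(2) by simp
    then have "p \<in> image_pairs F n \<phi>"
      using e p(1) unfolding image_pairs_def by blast
    with d show "d \<in> (\<lambda>p. {fst p, snd p}) ` image_pairs F n \<phi>" by blast
  qed (auto simp: image_pairs_def)
  also have "(\<Prod>d\<in>(\<lambda>p. {fst p, snd p}) ` image_pairs F n \<phi>. edge_weight W u d)
      = (\<Prod>p\<in>image_pairs F n \<phi>. edge_weight W u {fst p, snd p})"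
    by (subst prod.reindex) (auto intro: inj_on_subset[OF inj_on_node_pairs] simp: image_pairs_def)
  also have "\<dots> = (\<Prod>p\<in>image_pairs F n \<phi>. W (u (fst p)) (u (snd p)))"
  proof (rule prod.cong[OF refl])
    fix p assume "p \<in> image_pairs F n \<phi>"
    then have "fst p \<in> {1..n}" "snd p \<in> {1..n}"
      by (auto simp: image_pairs_def node_pairs_def)
    then have "u (fst p) \<in> {0..1}" "u (snd p) \<in> {0..1}"
      using u by blast+
    then show "edge_weight W u {fst p, snd p} = W (u (fst p)) (u (snd p))"
      by (rule edge_weight_graphon[OF W])
  qed
  finally show ?thesis .
qed

text \<open>An injective \<open>\<phi>\<close> selects independent uniform points, so the reindexed
  points have the product law over \<open>verts F\<close> and the integral becomes the one defining
  the graphon density.\<close>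

lemma integral_prob_hom_inj:
  assumes F: "finite_simple_graph F" and W: "graphon W"
    and \<phi>: "\<phi> \<in> verts F \<rightarrow>\<^sub>E {1..n}" and inj: "inj_on \<phi> (verts F)"
  shows "(\<integral>u. measure_pmf.prob (cond_W_random_graph n W u) {G. \<phi> \<in> homs F G} \<partial>(\<Pi>\<^sub>M i\<in>{1..n}. unit_lborel))
    = graphon_density F W"
proof -
  let ?M = "\<Pi>\<^sub>M i\<in>{1..n}. unit_lborel" and ?L = "\<Pi>\<^sub>M i\<in>verts F. unit_lborel"
  have inj_e: "injective_on_edges F \<phi>"
    unfolding injective_on_edges_def
  proof
    fix e assume e: "e \<in> edges F"
    then have "e \<subseteq> verts F" "card e = 2"
      using F by (auto simp: finite_simple_graph_def)
    then show "card (\<phi> ` e) = 2"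
      using inj by (simp add: card_image inj_on_subset)
  qed
  have \<phi>': "\<phi> \<in> verts F \<rightarrow> {1..n}" using \<phi> by auto
  have "graphon_density F W
      = (\<integral>x. (\<Prod>e\<in>edges F. edge_weight W x e) \<partial>distr ?M ?L (\<lambda>u. \<lambda>v\<in>verts F. u (\<phi> v)))"
    unfolding graphon_density_def
    using distr_PiM_reindex[OF _ inj \<phi>', of "\<lambda>_. unit_lborel"] prob_space_unit_lborel by simp
  also have "\<dots> = (\<integral>u. (\<Prod>e\<in>edges F. edge_weight W (\<lambda>v\<in>verts F. u (\<phi> v)) e) \<partial>?M)"
    using \<phi>' by (intro integral_distr measurable_prod_edge_weight[OF F W] measurable_restrict
        measurable_component_singleton) auto
  also have "\<dots> = (\<integral>u. measure_pmf.prob (cond_W_random_graph n W u) {G. \<phi> \<in> homs F G} \<partial>?M)"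
    using inj_e prod_edge_weight_compose[OF F W \<phi> inj] prob_hom_cond_W_random_graph[OF F \<phi> W]
    by (intro Bochner_Integration.integral_cong) (auto simp: space_PiM)
  finally show ?thesis ..
qed

text \<open>Injective maps contribute no bias. Any other map contributes at most 1, the largest
  difference of two numbers in the unit interval, so the bias is at most the fraction of
  non-injective maps.\<close>

lemma mean_hom_density_bias:
  assumes F: "finite_simple_graph F" and W: "graphon W" and n: "n \<ge> 1"
  shows "\<bar>(\<integral>u. measure_pmf.expectation (cond_W_random_graph n W u) (hom_density F) \<partial>(\<Pi>\<^sub>M i\<in>{1..n}. unit_lborel))
      - graphon_density F W\<bar> \<le> (real (num_verts F))\<^sup>2 / real n"
proof -
  let ?M = "\<Pi>\<^sub>M i\<in>{1..n}. unit_lborel" and ?X = "verts F \<rightarrow>\<^sub>E {1..n}" and ?t = "graphon_density F W"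
  let ?q = "\<lambda>u \<phi>. measure_pmf.prob (cond_W_random_graph n W u) {G. \<phi> \<in> homs F G}"
  interpret prob_space ?M by (rule prob_space_sample_points)
  have V: "finite (verts F)"
    using F by (simp add: finite_simple_graph_def)
  have X: "finite ?X" "real (card ?X) = real n ^ num_verts F"
    using V by (auto intro: finite_PiE simp: card_funcsetE)
  have "(\<lambda>u. ?q u \<phi>) \<in> borel_measurable ?M" for \<phi>
    by (intro measurable_compose[OF cond_W_random_graph_measurable[OF W]] measurable_measure_subprob_algebra) simp
  then have int: "integrable ?M (\<lambda>u. ?q u \<phi>)" for \<phi>
    by (intro integrable_const_bound[where B = 1]) auto
  have q: "0 \<le> (\<integral>u. ?q u \<phi> \<partial>?M)" "(\<integral>u. ?q u \<phi> \<partial>?M) \<le> 1" for \<phi>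
  proof -
    have "(\<integral>u. ?q u \<phi> \<partial>?M) \<le> (\<integral>u. 1 \<partial>?M)"
      by (intro integral_mono int integrable_const) simp
    then show "(\<integral>u. ?q u \<phi> \<partial>?M) \<le> 1" by (simp add: prob_space del: One_nat_def)
  qed auto
  have bias: "\<bar>(\<integral>u. ?q u \<phi> \<partial>?M) - ?t\<bar> \<le> indicator {\<phi>. \<not> inj_on \<phi> (verts F)} \<phi>" if "\<phi> \<in> ?X" for \<phi>
  proof (cases "inj_on \<phi> (verts F)")
    case True
    then show ?thesis using integral_prob_hom_inj[OF F W that] by simp
  next
    case False
    have "\<bar>(\<integral>u. ?q u \<phi> \<partial>?M) - ?t\<bar> \<le> 1"
      using q[of \<phi>] graphon_density_bounds[OF F W] by linarith
    then show ?thesis using False by simp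
  qed
  \<comment> \<open>The constant \<open>?t\<close> is written as its own average over all maps,
    which allows a comparison map by map; \<open>n \<ge> 1\<close> keeps the denominator
    nonzero.\<close>
  have "(\<integral>u. measure_pmf.expectation (cond_W_random_graph n W u) (hom_density F) \<partial>?M) - ?t
      = (\<Sum>\<phi>\<in>?X. (\<integral>u. ?q u \<phi> \<partial>?M)) / real n ^ num_verts F - (\<Sum>\<phi>\<in>?X. ?t) / real n ^ num_verts F"
    unfolding expectation_hom_density_cond_W_random_graph[OF F] using int n X(2) by simp
  also have "\<dots> = (\<Sum>\<phi>\<in>?X. (\<integral>u. ?q u \<phi> \<partial>?M) - ?t) / real n ^ num_verts F"
    by (simp only: sum_subtractf diff_divide_distrib)
  also have "\<bar>\<dots>\<bar> \<le> (\<Sum>\<phi>\<in>?X. indicator {\<phi>. \<not> inj_on \<phi> (verts F)} \<phi>) / real n ^ num_verts F"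
    using bias by (auto simp: abs_divide intro!: divide_right_mono order.trans[OF sum_abs] sum_mono)
  also have "\<dots> = real (card {\<phi> \<in> ?X. \<not> inj_on \<phi> (verts F)}) / real (card {1..n}) ^ num_verts F"
    using X(1) by (simp add: indicator_def sum.If_cases Int_def)
  also have "\<dots> \<le> (real (num_verts F))\<^sup>2 / real (card {1..n})"
    using V n by (intro card_PiE_not_inj_le) auto
  finally show ?thesis by simp
qed

section \<open>Choice of constants and conclusion\<close>

theorem graphon_concentration:
  assumes W: "graphon W" and n: "n \<ge> 1" and eps: "0 < eps" "eps < 1" and F: "finite_simple_graph F"
  shows "measure (W_random_graph n W) {G. \<bar>hom_density F G - graphon_density F W\<bar> > eps}
    \<le> 2 * exp (- (eps\<^sup>2 * real n / (8 * (real (num_verts F))\<^sup>2)))"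
proof -
  interpret prob_space "W_random_graph n W"
    using W by (rule prob_space_W_random_graph)
  define k where "k = real (num_verts F)"
  define N where "N = real n"
  have N: "N > 0" using n by (simp add: N_def)
  show ?thesis
  proof (cases "eps\<^sup>2 * N \<le> 4 * k\<^sup>2")
    case True
    \<comment> \<open>By \<open>exp x \<ge> 1 + x\<close> the exponential is then at least 1/2, so
      the claimed bound is at least 1.\<close>
    have "eps\<^sup>2 * N / (8 * k\<^sup>2) \<le> 1 / 2"
      using True by (cases "k = 0") (auto simp: field_simps)
    then have "1 - 1 / 2 \<le> exp (- (eps\<^sup>2 * N / (8 * k\<^sup>2)))"
      using exp_ge_add_one_self[of "- (eps\<^sup>2 * N / (8 * k\<^sup>2))"] by linarith
    moreover have "prob {G. \<bar>hom_density F G - graphon_density F W\<bar> > eps} \<le> 1"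
      by (rule prob_le_1)
    ultimately show ?thesis
      unfolding k_def[symmetric] N_def[symmetric] by linarith
  next
    case False
    show ?thesis
    proof (cases "k = 0")
      case True
      \<comment> \<open>the exponent is a division by zero, hence 0\<close>
      have "prob {G. \<bar>hom_density F G - graphon_density F W\<bar> > eps} \<le> 1"
        by (rule prob_le_1)
      also have "1 \<le> 2 * exp (- (eps\<^sup>2 * real n / (8 * (real (num_verts F))\<^sup>2)))"
        using True by (simp add: k_def)
      finally show ?thesis .
    next
      case k: False
      let ?g = "\<lambda>u. measure_pmf.expectation (cond_W_random_graph n W u) (hom_density F)"
      define \<mu> where "\<mu> = (\<integral>u. ?g u \<partial>(\<Pi>\<^sub>M i\<in>{1..n}. unit_lborel))"
      \<comment> \<open>\<open>s\<close> is what remains of \<open>eps\<close> after a bias of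
        \<open>eps / 4\<close>. \<open>V\<close> dominates the variance proxy, and \<open>l\<close>
        minimizes \<open>l\<^sup>2 * V / 8 - l * s\<close>, with minimum
        \<open>- (2 * s\<^sup>2 / V)\<close>.\<close>
      define s where "s = 3 / 4 * eps"
      define V where "V = 5 / 4 * (k\<^sup>2 / N)"
      define l where "l = 4 * s / V"
      have pos: "k\<^sup>2 > 0" "V > 0" "s > 0" "l > 0"
        using k N eps by (auto simp: V_def s_def l_def)
      have eps2: "eps\<^sup>2 \<le> eps" "eps\<^sup>2 \<le> 1"
        using eps by (auto simp: power2_eq_square mult_le_one)
      have kN: "k\<^sup>2 / N \<le> eps\<^sup>2 / 4"
        using False N by (simp add: field_simps)
      have bias: "\<bar>\<mu> - graphon_density F W\<bar> \<le> eps / 4"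
        using mean_hom_density_bias[OF F W n] kN eps2(1)
        unfolding \<mu>_def[symmetric] k_def[symmetric] N_def[symmetric] by linarith
      \<comment> \<open>With at most \<open>N\<^sup>2\<close> pairs, the edge stage contributes at
        most the square of \<open>k\<^sup>2 / N\<close>; as
        \<open>k\<^sup>2 / N \<le> 1 / 4\<close>, this is at most a quarter of the contribution of
        the node stage.\<close>
      have var: "real (card (node_pairs n)) * (k\<^sup>2 / N\<^sup>2)\<^sup>2 + N * (k / N)\<^sup>2 \<le> V"
      proof -
        have "card (node_pairs n) \<le> card ({1..n} \<times> {1..n})"
          by (intro card_mono) (auto simp: node_pairs_def)
        then have "real (card (node_pairs n)) \<le> N\<^sup>2"
          by (simp add: N_def power2_eq_square flip: of_nat_mult)
        then have "real (card (node_pairs n)) * (k\<^sup>2 / N\<^sup>2)\<^sup>2 \<le> N\<^sup>2 * (k\<^sup>2 / N\<^sup>2)\<^sup>2"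
          by (rule mult_right_mono) simp
        also have "\<dots> = (k\<^sup>2 / N) * (k\<^sup>2 / N)"
          using N by (simp add: field_simps power2_eq_square)
        also have "\<dots> \<le> (1 / 4) * (k\<^sup>2 / N)"
        proof (rule mult_right_mono)
          show "k\<^sup>2 / N \<le> 1 / 4"
            using kN eps2(2) by linarith
        qed (use N in simp)
        finally show ?thesis
          using N by (simp add: V_def power2_eq_square)
      qed
      have exponent: "l\<^sup>2 * V' / 8 - l * s \<le> - (eps\<^sup>2 * N / (8 * k\<^sup>2))" if "V' \<le> V" for V'
      proof -
        have "l\<^sup>2 * V' / 8 - l * s \<le> l\<^sup>2 * V / 8 - l * s"
          using that by (simp add: mult_left_mono)
        also have "\<dots> = - (2 * s\<^sup>2 / V)"
          using pos by (simp add: l_def field_simps power2_eq_square)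
        \<comment> \<open>From \<open>2 * (3 / 4)\<^sup>2 / (5 / 4) = 9 / 10\<close>, well above the
          required 1/8.\<close>
        also have "\<dots> = - (9 / 10 * (eps\<^sup>2 * N / k\<^sup>2))"
          using pos N by (simp add: s_def V_def field_simps power2_eq_square)
        also have "\<dots> \<le> - (1 / 8 * (eps\<^sup>2 * N / k\<^sup>2))"
        proof -
          have "0 \<le> eps\<^sup>2 * N / k\<^sup>2"
            using N by (intro divide_nonneg_nonneg) auto
          then show ?thesis by linarith
        qed
        finally show ?thesis by simp
      qed
      have bound: "\<bar>hom_density F G\<bar> \<le> 1" for G :: "nat ugraph"
        using hom_density_bounds[OF F, of G] by simp
      have "prob {G. s \<le> hom_density F G - \<mu>}
          \<le> exp (l\<^sup>2 * (real (card (node_pairs n)) * ((real (num_verts F))\<^sup>2 / (real n)\<^sup>2)\<^sup>2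
              + real n * (real (num_verts F) / real n)\<^sup>2) / 8 - l * s)"
        unfolding \<mu>_def
        by (intro W_random_graph_tail[OF W bound] hom_density_graph_of_choice_diff[OF F]
            expectation_hom_density_node_diff[OF F W] pos)
      \<comment> \<open>The lower tail is the upper tail of the negated density, which has the same
        differences and mean \<open>- \<mu>\<close>.\<close>
      moreover have "prob {G. s \<le> - hom_density F G - - \<mu>}
          \<le> exp (l\<^sup>2 * (real (card (node_pairs n)) * ((real (num_verts F))\<^sup>2 / (real n)\<^sup>2)\<^sup>2
              + real n * (real (num_verts F) / real n)\<^sup>2) / 8 - l * s)"
        using W_random_graph_tail[OF W, of "\<lambda>G. - hom_density F G" 1 n
            "(real (num_verts F))\<^sup>2 / (real n)\<^sup>2" "real (num_verts F) / real n" l s]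
          bound hom_density_graph_of_choice_diff[OF F] expectation_hom_density_node_diff[OF F W] pos
        by (simp add: \<mu>_def abs_minus_commute)
      \<comment> \<open>A deviation above \<open>eps\<close> from the graphon density exceeds
        \<open>eps - eps / 4 = s\<close> around \<open>\<mu>\<close>, on one side or the
        other.\<close>
      moreover have "prob {G. \<bar>hom_density F G - graphon_density F W\<bar> > eps}
          \<le> prob ({G. s \<le> hom_density F G - \<mu>} \<union> {G. s \<le> - hom_density F G - - \<mu>})"
        using bias by (intro finite_measure_mono) (auto simp: s_def abs_if split: if_splits)
      moreover have "\<dots> \<le> prob {G. s \<le> hom_density F G - \<mu>} + prob {G. s \<le> - hom_density F G - - \<mu>}"
        by (rule measure_Un_le) auto
      moreover have "exp (l\<^sup>2 * (real (card (node_pairs n)) * ((real (num_verts F))\<^sup>2 / (real n)\<^sup>2)\<^sup>2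
              + real n * (real (num_verts F) / real n)\<^sup>2) / 8 - l * s)
          \<le> exp (- (eps\<^sup>2 * real n / (8 * (real (num_verts F))\<^sup>2)))"
        using exponent[OF var] by (simp add: k_def N_def)
      ultimately show ?thesis by linarith
    qed
  qed
qed

text \<open>A convex combination of graphons is again a graphon, so concentration for a single
  graphon applies to the mixture.\<close>

theorem theorem4p3:
  fixes WG WH :: "real \<Rightarrow> real \<Rightarrow> real" and F :: "'a ugraph"
    and lam eps :: real and n :: nat
  assumes "graphon WG" and "graphon WH"
    and "0 \<le> lam" and "lam \<le> 1"
    and "n \<ge> 1" and "0 < eps" and "eps < 1"
    and "finite_simple_graph F"
  shows "measure (W_random_graph n (mixed_graphon lam WG WH))
           {G. \<bar>hom_density F G - graphon_density F (mixed_graphon lam WG WH)\<bar> > eps}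
         \<le> 2 * exp (- (eps\<^sup>2 * real n / (8 * (real (num_verts F))\<^sup>2)))"
  using graphon_concentration[OF graphon_mixed_graphon[OF assms(1-4)] assms(5-8)] .

end
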